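(* Let $N\geq 3$ be an integer. Define operators $\Sigma^{+},\Sigma^{-}$ on $(\mathbb{C}^2)^{\otimes N}$ by $$\Sigma^\pm=\sum_{\substack{r_1,\dots,r_N\in\{-1,0,1\}\\ r_1+\dots+r_N=\pm1}}\sigma_1^{r_1}\cdots\sigma_N^{r_N},$$ where $\sigma_i^{0}=1$ and $\sigma_i^{\pm1}=\sigma_i^{\pm}$; equivalently, $$\Sigma^\pm=\operatorname*{res}_{\lambda=0}\ \prod_{i=1}^N\Bigl(\lambda^{-1}\sigma_i^{\pm}+1+\lambda\sigma_i^{\mp}\Bigr).$$ Then $\Sigma^{+}$ and $\Sigma^{-}$ act on the ground states $\lvert v_{S^z}\rangle$, $S^z\in\{-\frac N2,-\frac N2+1,\dots,\frac N2\}$, of the periodic Fredkin chain as raising and lowering operators, respectively: for each choice of sign there are constants $c_\pm(S^z)\neq 0$ such that $$\Sigma^\pm\lvert v_{S^z}\rangle=\begin{cases}c_\pm(S^z)\,\lvert v_{S^z\pm1}\rangle, & S^z\neq\pm N/2,\\ 0, & S^z=\pm N/2.\end{cases}$$ Moreover, these operators commute with the Hamiltonian $\mathrm{H}$ of the periodic Fredkin chain: $[\Sigma^\pm,\mathrm{H}]=0$.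
   Context: Basis of $\mathbb{C}^2$: $\lvert\uparrow\rangle=\begin{pmatrix}1\\0\end{pmatrix}$, $\lvert\downarrow\rangle=\begin{pmatrix}0\\1\end{pmatrix}$. Matrices: $\sigma^{+}=\begin{pmatrix}0&1\\0&0\end{pmatrix}$, $\sigma^{-}=\begin{pmatrix}0&0\\1&0\end{pmatrix}$, $\sigma^{z}=\begin{pmatrix}1&0\\0&-1\end{pmatrix}$, $n^\uparrow=\frac12(1+\sigma^z)$, $n^\downarrow=\frac12(1-\sigma^z)$. A subscript $j$ (as in $\sigma_j^\pm$, $n_j^\uparrow$) means that the operator acts in the $j$th tensor factor ("site") of $(\mathbb{C}^2)^{\otimes N}$ and as the identity in the others. Basis vectors of $(\mathbb{C}^2)^{\otimes N}$ are $\lvert\ell_1\ell_2\dots\ell_N\rangle=\lvert\ell_1\rangle\otimes\cdots\otimes\lvert\ell_N\rangle$ with $\ell_j\in\{\uparrow,\downarrow\}$. Hamiltonian. Let $\mathrm{P}_{j,j+1}$ be the operator exchanging the $j$th and $(j+1)$th tensor factors and $\Pi_{j,j+1}=\frac12(1-\mathrm{P}_{j,j+1})$. The Fredkin Hamiltonian density is $\mathrm{F}_{j,j+1,j+2}=n_j^\uparrow\,\Pi_{j+1,j+2}+\Pi_{j,j+1}\,n_{j+2}^\downarrow$, and the periodic Fredkin chain Hamiltonian is $\mathrm{H}=\sum_{j=1}^N\mathrm{F}_{j,j+1,j+2}$, with site indices taken modulo $N$. Ground states. For integers $a,b\geq0$, $C_{a,b}(N)$ denotes the set of lattice paths of length $N$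 that start at $(x,y)=(0,a)$, end at $(x,y)=(N,b)$, have steps with $\Delta x=1$ and $\Delta y=\pm1$, and satisfy $\min y=0$ along the path (so the path stays in $y\geq0$ and touches the $x$-axis at least once). A word $\ell_1\dots\ell_N$ in the letters $\uparrow,\downarrow$ is identified with the path whose $j$th step is up if $\ell_j=\uparrow$ and down if $\ell_j=\downarrow$ (the starting height being determined by $\min y=0$). Put $\lvert C_{a,b}(N)\rangle=\sum_{\ell_1\dots\ell_N\in C_{a,b}(N)}\lvert\ell_1\dots\ell_N\rangle$ (zero if the set is empty), and for $S^z\in\{-\frac N2,-\frac N2+1,\dots,\frac N2\}$ put $$\lvert v_{S^z}\rangle=\sum_{\substack{a,b\geq0\\ b-a=2S^z}}\lvert C_{a,b}(N)\rangle .$$ The residue $\operatorname*{res}_{\lambda=0}$ of an operator-valued Laurent polynomial in $\lambda$ is its coefficient of $\lambda^{-1}$. *)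

theory Defs
  imports Complex_Main "HOL-Library.Function_Algebras"
begin

text \<open>
  A vector of the $N$-fold tensor power of $C^2$ is given by its coefficients in the basis of
  words of length $N$: it is a function on spin lists vanishing on lists of any other length.
  Sites are numbered $0, \dots, N-1$. Addition, subtraction, \<open>0\<close> and \<open>sum\<close> on states and on
  operators are pointwise (theory \<open>Function_Algebras\<close>); the pointwise \<open>*\<close> and \<open>1\<close> of that theory are
  never used on them, products of operators being written with \<open>\<circ>\<close> and the identity as \<open>id\<close>.
\<close>

datatype spin = Up | Down

type_synonym vec2 = "spin \<Rightarrow> complex"
type_synonym mat2 = "spin \<Rightarrow> spin \<Rightarrow> complex"
type_synonym state = "spin list \<Rightarrow> complex"
type_synonym operator = "state \<Rightarrow> state"

definition state_space :: "nat \<Rightarrow> state set" where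
  "state_space N = {\<psi>. \<forall>w. length w \<noteq> N \<longrightarrow> \<psi> w = 0}"

definition scale :: "complex \<Rightarrow> state \<Rightarrow> state" where
  "scale c \<psi> = (\<lambda>w. c * \<psi> w)"

definition tensor :: "vec2 list \<Rightarrow> state" where
  "tensor vs = (\<lambda>w. if length w = length vs then \<Prod>i<length vs. (vs ! i) (w ! i) else 0)"

definition basis2 :: "spin \<Rightarrow> vec2" where
  "basis2 s = (\<lambda>t. if t = s then 1 else 0)"

definition ket :: "spin list \<Rightarrow> state" where
  "ket w = tensor (map basis2 w)"


subsection \<open>Operators acting on single sites\<close>

definition mat2_apply :: "mat2 \<Rightarrow> vec2 \<Rightarrow> vec2" where
  "mat2_apply A v = (\<lambda>s. \<Sum>t\<in>{Up, Down}. A s t * v t)"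

definition mat2_id :: mat2 where
  "mat2_id s t = (if s = t then 1 else 0)"

definition sigma_plus :: mat2 where
  "sigma_plus s t = (if s = Up \<and> t = Down then 1 else 0)"

definition sigma_minus :: mat2 where
  "sigma_minus s t = (if s = Down \<and> t = Up then 1 else 0)"

definition sigma_z :: mat2 where
  "sigma_z s t = (if s = t then (if s = Up then 1 else -1) else 0)"

definition n_up :: mat2 where
  "n_up s t = (mat2_id s t + sigma_z s t) / 2"

definition n_down :: mat2 where
  "n_down s t = (mat2_id s t - sigma_z s t) / 2"

text \<open>
  The matrix \<open>A\<close> acting in tensor factor \<open>j\<close> and as the identity in the others; see
  \<open>site_op_tensor\<close> below.
\<close>

definition site_op :: "mat2 \<Rightarrow> nat \<Rightarrow> operator" where
  "site_op A j \<psi> = (\<lambda>w. \<Sum>t\<in>{Up, Down}. A (w ! j) t * \<psi> (w[j := t]))"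

definition exchange :: "nat \<Rightarrow> nat \<Rightarrow> operator" where
  "exchange i j \<psi> = (\<lambda>w. \<psi> (w[i := w ! j, j := w ! i]))"


subsection \<open>The periodic Fredkin chain\<close>

definition Pi_op :: "nat \<Rightarrow> nat \<Rightarrow> operator" where
  "Pi_op i j = (\<lambda>\<psi>. scale (1/2) (\<psi> - exchange i j \<psi>))"

definition fredkin_density :: "nat \<Rightarrow> nat \<Rightarrow> nat \<Rightarrow> operator" where
  "fredkin_density i j k = (site_op n_up i \<circ> Pi_op j k) + (Pi_op i j \<circ> site_op n_down k)"

definition fredkin_H :: "nat \<Rightarrow> operator" where
  "fredkin_H N = (\<Sum>j<N. fredkin_density j ((j + 1) mod N) ((j + 2) mod N))"


subsection \<open>Lattice paths and the ground states\<close>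

definition step :: "spin \<Rightarrow> int" where
  "step s = (case s of Up \<Rightarrow> 1 | Down \<Rightarrow> -1)"

definition height :: "nat \<Rightarrow> spin list \<Rightarrow> nat \<Rightarrow> int" where
  "height a w k = int a + (\<Sum>i<k. step (w ! i))"

definition path_words :: "nat \<Rightarrow> nat \<Rightarrow> nat \<Rightarrow> spin list set" where
  "path_words N a b =
     {w. length w = N \<and> height a w N = int b \<and> Min (height a w ` {..N}) = 0}"

definition path_state :: "nat \<Rightarrow> nat \<Rightarrow> nat \<Rightarrow> state" where
  "path_state N a b = (\<Sum>w\<in>path_words N a b. ket w)"

text \<open>
  The bounds \<open>a \<le> N\<close> and \<open>b \<le> N\<close> only make the index set finite; the omitted summands
  vanish by \<open>path_words_bounds\<close> below.
\<close>

definition ground_state :: "nat \<Rightarrow> real \<Rightarrow> state" where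
  "ground_state N S =
     (\<Sum>(a, b)\<in>{(a, b). a \<le> N \<and> b \<le> N \<and> real b - real a = 2 * S}. path_state N a b)"

definition spin_values :: "nat \<Rightarrow> real set" where
  "spin_values N = {- real N / 2 + real k |k. k \<le> N}"


subsection \<open>The raising and lowering operators\<close>

definition sigma_pow :: "int \<Rightarrow> nat \<Rightarrow> operator" where
  "sigma_pow r i =
     (if r = 1 then site_op sigma_plus i else if r = -1 then site_op sigma_minus i else id)"

text \<open>\<open>op_prod\<close> of a list of operators is their product in the order of the list.\<close>

definition op_prod :: "operator list \<Rightarrow> operator" where
  "op_prod As = foldr (\<circ>) As id"

text \<open>\<open>ladder N 1\<close> is $\Sigma^+$ and \<open>ladder N (-1)\<close> is $\Sigma^-$.\<close>

definition ladder :: "nat \<Rightarrow> int \<Rightarrow> operator" where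
  "ladder N e =
     (\<Sum>r\<in>{r. length r = N \<and> set r \<subseteq> {-1, 0, 1} \<and> sum_list r = e}.
        op_prod (map (\<lambda>i. sigma_pow (r ! i) i) [0..<N]))"

text \<open>
  An operator-valued Laurent polynomial is given by its coefficient function, which has finite
  support; multiplication is the Cauchy product.
\<close>

type_synonym op_laurent = "int \<Rightarrow> operator"

definition laurent_one :: op_laurent where
  "laurent_one k = (if k = 0 then id else 0)"

definition laurent_mult :: "op_laurent \<Rightarrow> op_laurent \<Rightarrow> op_laurent" where
  "laurent_mult f g k = (\<Sum>i\<in>{i. f i \<noteq> 0}. f i \<circ> g (k - i))"

definition laurent_prod :: "op_laurent list \<Rightarrow> op_laurent" where
  "laurent_prod fs = foldr laurent_mult fs laurent_one"

definition laurent_res :: "op_laurent \<Rightarrow> operator" where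
  "laurent_res f = f (-1)"

text \<open>
  The factor $\lambda^{-1} \sigma_i^{\pm} + 1 + \lambda \sigma_i^{\mp}$, with upper signs for
  \<open>e = 1\<close> and lower signs for \<open>e = -1\<close>.
\<close>

definition ladder_factor :: "int \<Rightarrow> nat \<Rightarrow> op_laurent" where
  "ladder_factor e i k =
     (if k = -1 then sigma_pow e i else if k = 0 then id
      else if k = 1 then sigma_pow (- e) i else 0)"


subsection \<open>Consistency of the encoding\<close>

lemma ket_apply: "ket w w' = (if w' = w then 1 else 0)"
proof (cases "length w' = length w \<and> w' \<noteq> w")
  case True
  then obtain i where "i < length w" "w' ! i \<noteq> w ! i"
    by (metis nth_equalityI)
  then show ?thesis
    using True by (auto simp: ket_def tensor_def basis2_def intro!: prod_zero)
next
  case False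
  then show ?thesis
    by (auto simp: ket_def tensor_def basis2_def)
qed

lemma ket_in_state_space: "ket w \<in> state_space (length w)"
  by (auto simp: state_space_def ket_apply)

lemma site_op_in_state_space:
  "\<psi> \<in> state_space N \<Longrightarrow> site_op A j \<psi> \<in> state_space N"
  by (auto simp: state_space_def site_op_def)

lemma exchange_in_state_space:
  "\<psi> \<in> state_space N \<Longrightarrow> exchange i j \<psi> \<in> state_space N"
  by (auto simp: state_space_def exchange_def)

lemma site_op_tensor:
  assumes "j < length vs"
  shows "site_op A j (tensor vs) = tensor (vs[j := mat2_apply A (vs ! j)])"
proof
  fix w :: "spin list"
  show "site_op A j (tensor vs) w = tensor (vs[j := mat2_apply A (vs ! j)]) w"
  proof (cases "length w = length vs")
    case True
    define R where "R = (\<Prod>i\<in>{..<length vs} - {j}. (vs ! i) (w ! i))"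
    have 1: "(\<Prod>i<length vs. (vs ! i) (w[j := t] ! i)) = (vs ! j) t * R" for t
      unfolding R_def using assms True by (subst prod.remove[of _ j]) auto
    have 2: "(\<Prod>i<length vs. (vs[j := mat2_apply A (vs ! j)] ! i) (w ! i))
               = mat2_apply A (vs ! j) (w ! j) * R"
      unfolding R_def using assms by (subst prod.remove[of _ j]) auto
    show ?thesis
      using True by (simp add: site_op_def tensor_def 1 2) (simp add: mat2_apply_def algebra_simps)
  qed (simp add: site_op_def tensor_def)
qed

lemma exchange_tensor:
  assumes "i < length vs" "j < length vs" "i \<noteq> j"
  shows "exchange i j (tensor vs) = tensor (vs[i := vs ! j, j := vs ! i])"
proof
  fix w :: "spin list"
  show "exchange i j (tensor vs) w = tensor (vs[i := vs ! j, j := vs ! i]) w"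
  proof (cases "length w = length vs")
    case True
    define R where "R = (\<Prod>k\<in>{..<length vs} - {i} - {j}. (vs ! k) (w ! k))"
    have 1: "(\<Prod>k<length vs. (vs ! k) (w[i := w ! j, j := w ! i] ! k))
               = (vs ! i) (w ! j) * ((vs ! j) (w ! i) * R)"
      unfolding R_def using assms True
      by (subst prod.remove[of _ i]; (subst prod.remove[of _ j])?) auto
    have 2: "(\<Prod>k<length vs. (vs[i := vs ! j, j := vs ! i] ! k) (w ! k))
               = (vs ! j) (w ! i) * ((vs ! i) (w ! j) * R)"
      unfolding R_def using assms
      by (subst prod.remove[of _ i]; (subst prod.remove[of _ j])?) auto
    show ?thesis
      using True by (simp add: exchange_def tensor_def 1 2 algebra_simps)
  qed (simp add: exchange_def tensor_def)
qed

lemma fredkin_density_apply: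
  "fredkin_density i j k \<psi> =
     site_op n_up i (Pi_op j k \<psi>) + Pi_op i j (site_op n_down k \<psi>)"
  by (simp add: fredkin_density_def)

lemma path_words_bounds:
  assumes "w \<in> path_words N a b"
  shows "a \<le> N \<and> b \<le> N"
proof -
  have "Min (height a w ` {..N}) \<in> height a w ` {..N}"
    by (intro Min_in) auto
  moreover have "Min (height a w ` {..N}) = 0"
    using assms by (simp add: path_words_def)
  ultimately obtain k where k: "k \<le> N" "height a w k = 0"
    by (metis (no_types, lifting) atMost_iff imageE)
  have st: "\<bar>step s\<bar> = 1" for s
    by (cases s) (auto simp: step_def)
  have "\<bar>\<Sum>i<k. step (w ! i)\<bar> \<le> (\<Sum>i<k. \<bar>step (w ! i)\<bar>)"
    by (rule sum_abs)
  then have "int a \<le> int k"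
    using k(2) by (simp add: height_def st)
  moreover have "\<bar>\<Sum>i=k..<N. step (w ! i)\<bar> \<le> (\<Sum>i=k..<N. \<bar>step (w ! i)\<bar>)"
    by (rule sum_abs)
  then have "\<bar>\<Sum>i=k..<N. step (w ! i)\<bar> \<le> int N - int k"
    using k(1) by (simp add: st of_nat_diff)
  moreover have "(\<Sum>i<N. step (w ! i)) = (\<Sum>i<k. step (w ! i)) + (\<Sum>i=k..<N. step (w ! i))"
    using k(1) by (simp add: lessThan_atLeast0 sum.atLeastLessThan_concat)
  then have "height a w N = height a w k + (\<Sum>i=k..<N. step (w ! i))"
    by (simp add: height_def)
  ultimately show ?thesis
    using assms k by (auto simp: path_words_def)
qed

end

theory Submission
  imports Defs "HOL-Library.Multiset"
begin

text \<open>
  Every word belongs to exactly one of the path sets \<open>path_words N a b\<close>, with \<open>a\<close> read off from its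
  lowest prefix sum. Hence the ground state of spin \<open>S\<close> is the sum of all basis words of total spin
  \<open>S\<close>. Likewise, for two words of length \<open>N\<close> exactly one choice of exponents takes the one to the
  other, so $\Sigma^\pm$ is the sum of the rank-one operators
  $\lvert v_{S\pm1}\rangle\langle v_S\rvert$. It remains to observe that the Hamiltonian
  annihilates the states $\lvert v_S\rangle$ from the left and from the right, because it is built
  from differences \<open>1 - P\<close> and the sectors are invariant under exchanging sites.
\<close>

section \<open>Words graded by magnetization, twice the eigenvalue of the total spin\<close>

definition mag :: "spin list \<Rightarrow> int" where
  "mag w = sum_list (map step w)"

definition sector :: "nat \<Rightarrow> int \<Rightarrow> spin list set" where
  "sector N M = {w. length w = N \<and> mag w = M}"

lemma sum_fun_apply: "(\<Sum>i\<in>A. f i) x = (\<Sum>i\<in>A. f i x)"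
  by (induction A rule: infinite_finite_induct) auto

lemma UNIV_spin: "(UNIV :: spin set) = {Up, Down}"
  using spin.exhaust by auto

instance spin :: finite
  by standard (simp add: UNIV_spin)

lemma finite_words: "finite {w :: spin list. length w = N}"
  using finite_lists_length_eq[of "UNIV :: spin set" N] by simp

lemma finite_sector: "finite (sector N M)"
  by (rule finite_subset[OF _ finite_words[of N]]) (auto simp: sector_def)

lemma abs_mag_le: "\<bar>mag w\<bar> \<le> int (length w)"
  by (induction w) (auto simp: mag_def step_def split: spin.splits)

lemma mag_eq_sum: "mag w = (\<Sum>i<length w. step (w ! i))"
  by (simp add: mag_def sum_list_sum_nth lessThan_atLeast0)

text \<open>Magnetization depends only on the multiset of letters.\<close>

lemma mag_swap:
  assumes "i < length w" "j < length w"
  shows "mag (w[i := w ! j, j := w ! i]) = mag w"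
proof -
  have *: "mag v = (\<Sum>s\<in>#mset v. step s)" for v
    by (simp add: mag_def flip: sum_mset_sum_list)
  show ?thesis
    unfolding * using mset_swap[of j w i] assms by simp
qed

lemma sum_sector_Suc:
  fixes f :: "spin list \<Rightarrow> 'a::comm_monoid_add"
  shows "(\<Sum>w\<in>sector (Suc N) M. f w) =
    (\<Sum>w\<in>sector N (M - 1). f (Up # w)) + (\<Sum>w\<in>sector N (M + 1). f (Down # w))"
proof -
  have "sector (Suc N) M = Cons Up ` sector N (M - 1) \<union> Cons Down ` sector N (M + 1)"
    (is "?L = ?R")
  proof
    show "?L \<subseteq> ?R"
    proof
      fix w assume w: "w \<in> ?L"
      then obtain c v where "w = c # v"
        by (cases w) (auto simp: sector_def)
      with w show "w \<in> ?R"
        by (cases c) (auto simp: sector_def mag_def step_def)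
    qed
  qed (auto simp: sector_def mag_def step_def)
  then have "(\<Sum>w\<in>sector (Suc N) M. f w) =
      (\<Sum>w\<in>Cons Up ` sector N (M - 1). f w) + (\<Sum>w\<in>Cons Down ` sector N (M + 1). f w)"
    by (simp only:) (subst sum.union_disjoint, auto simp: finite_sector)
  then show ?thesis
    by (simp add: sum.reindex)
qed


section \<open>The ground states\<close>

lemma path_state_apply: "path_state N a b w = (if w \<in> path_words N a b then 1 else 0)"
proof -
  have "finite (path_words N a b)"
    by (rule finite_subset[OF _ finite_words[of N]]) (auto simp: path_words_def)
  then show ?thesis
    by (simp add: path_state_def sum_fun_apply ket_apply)
qed

text \<open>Starting at height \<open>a\<close> shifts the lowest prefix sum \<open>m\<close> by
  \<open>a\<close>, so touching the axis forces \<open>a = -m\<close>; the end height is then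
  \<open>mag w - m\<close>. The empty and the full prefix show that both numbers are nonnegative, so
  \<open>nat\<close> truncates nothing.\<close>

lemma path_words_iff:
  assumes "length w = N"
  defines "m \<equiv> Min ((\<lambda>k. \<Sum>i<k. step (w ! i)) ` {..N})"
  shows "w \<in> path_words N a b \<longleftrightarrow> a = nat (- m) \<and> b = nat (mag w - m)"
proof -
  let ?p = "\<lambda>k. \<Sum>i<k. step (w ! i)"
  have "Min (height a w ` {..N}) = Min ((\<lambda>x. int a + x) ` ?p ` {..N})"
    by (simp add: height_def image_image)
  also have "\<dots> = int a + m"
    unfolding m_def by (rule mono_Min_commute[symmetric]) (auto simp: mono_def)
  finally have Min: "Min (height a w ` {..N}) = int a + m" .
  have "m \<le> ?p 0" "m \<le> ?p N"
    unfolding m_def by (rule Min_le; force)+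
  then have "m \<le> 0" "m \<le> mag w"
    using assms by (auto simp: mag_eq_sum)
  moreover have "height a w N = int a + mag w"
    using assms by (simp add: height_def mag_eq_sum)
  ultimately show ?thesis
    using assms(1) Min by (auto simp: path_words_def)
qed

lemma ground_state_apply:
  "ground_state N S w = (if length w = N \<and> real_of_int (mag w) = 2 * S then 1 else 0)"
proof -
  let ?A = "{(a, b). a \<le> N \<and> b \<le> N \<and> real b - real a = 2 * S}"
  have fin: "finite ?A"
    by (rule finite_subset[of _ "{..N} \<times> {..N}"]) auto
  have *: "ground_state N S w = (\<Sum>(a, b)\<in>?A. if w \<in> path_words N a b then 1 else 0)"
    by (simp add: ground_state_def sum_fun_apply path_state_apply case_prod_beta)
  show ?thesis
  proof (cases "length w = N")
    case True
    define m where "m = Min ((\<lambda>k. \<Sum>i<k. step (w ! i)) ` {..N})"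
    have iff: "w \<in> path_words N a b \<longleftrightarrow> (a, b) = (nat (- m), nat (mag w - m))" for a b
      using path_words_iff[OF True] by (simp add: m_def)
    have p: "w \<in> path_words N (nat (- m)) (nat (mag w - m))"
      by (simp add: iff)
    have "height (nat (- m)) w N = int (nat (mag w - m))"
      using p by (simp add: path_words_def)
    then have "int (nat (mag w - m)) - int (nat (- m)) = mag w"
      using True by (simp add: height_def mag_eq_sum)
    then have "real (nat (mag w - m)) - real (nat (- m)) = real_of_int (mag w)"
      by (metis of_int_diff of_int_of_nat_eq)
    \<comment> \<open>The bounds on path heights ensure that the finite cut-off of the index set
      does not lose the one contributing pair.\<close>
    then have mem: "(nat (- m), nat (mag w - m)) \<in> ?A \<longleftrightarrow> real_of_int (mag w) = 2 * S"
      using path_words_bounds[OF p] by simp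
    have "ground_state N S w = (\<Sum>p\<in>?A. if p = (nat (- m), nat (mag w - m)) then 1 else 0)"
      unfolding * iff by (rule sum.cong) (auto split: prod.splits if_splits)
    also have "\<dots> = (if (nat (- m), nat (mag w - m)) \<in> ?A then 1 else 0)"
      using fin by (rule sum.delta)
    finally show ?thesis
      unfolding mem using True by simp
  next
    case False
    then show ?thesis
      unfolding * by (auto simp: path_words_def intro!: sum.neutral)
  qed
qed


section \<open>The ladder operators\<close>

definition exps :: "nat \<Rightarrow> int \<Rightarrow> int list set" where
  "exps n s = {r. length r = n \<and> set r \<subseteq> {-1, 0, 1} \<and> sum_list r = s}"

lemma finite_exps: "finite (exps n s)"
  by (rule finite_subset[of _ "{r. set r \<subseteq> {-1, 0, 1} \<and> length r = n}"])
    (auto simp: exps_def intro: finite_lists_length_eq)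

lemma exps_0: "exps 0 s = (if s = 0 then {[]} else {})"
  by (auto simp: exps_def)

lemma sum_exps_Suc:
  "(\<Sum>r\<in>exps (Suc n) s. f r) = (\<Sum>j\<in>{-1, 0, 1}. \<Sum>r\<in>exps n (s - j). f (j # r))"
proof -
  have "(\<Sum>j\<in>{-1, 0, 1}. \<Sum>r\<in>exps n (s - j). f (j # r)) =
      (\<Sum>(j, r)\<in>(SIGMA j:{-1, 0, 1}. exps n (s - j)). f (j # r))"
    by (rule sum.Sigma) (auto simp: finite_exps)
  also have "\<dots> = (\<Sum>r\<in>exps (Suc n) s. f r)"
    by (rule sum.reindex_bij_witness[of _ "\<lambda>r. (hd r, tl r)" "\<lambda>(j, r). j # r"])
      (auto simp: exps_def length_Suc_conv)
  finally show ?thesis ..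
qed

text \<open>Generalizes \<open>ladder\<close> to any list of sites and any total exponent: splitting
  off the first site changes both.\<close>

definition ladder_on :: "nat list \<Rightarrow> int \<Rightarrow> operator" where
  "ladder_on xs s = (\<Sum>r\<in>exps (length xs) s. op_prod (map2 sigma_pow r xs))"

lemma ladder_eq_ladder_on: "ladder N e = ladder_on [0..<N] e"
proof -
  have "map (\<lambda>i. sigma_pow (r ! i) i) [0..<N] = map2 sigma_pow r [0..<N]"
    if "length r = N" for r
    using that by (auto intro: nth_equalityI)
  then show ?thesis
    by (auto simp: ladder_def ladder_on_def exps_def intro!: sum.cong)
qed

text \<open>Operators here are plain functions, so distributing composition over a sum on the right
  requires linearity.\<close>

lemma sigma_pow_sum: "sigma_pow r i (\<Sum>x\<in>A. f x) = (\<Sum>x\<in>A. sigma_pow r i (f x))"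
  by (auto simp: sigma_pow_def site_op_def fun_eq_iff sum_fun_apply sum_distrib_left sum.distrib)

lemma ladder_on_Nil: "ladder_on [] s = (if s = 0 then id else 0)"
  by (simp add: ladder_on_def exps_0 op_prod_def)

lemma ladder_on_Cons:
  "ladder_on (x # xs) s = (\<Sum>j\<in>{-1, 0, 1}. sigma_pow j x \<circ> ladder_on xs (s - j))"
proof -
  have "ladder_on (x # xs) s =
      (\<Sum>j\<in>{-1, 0, 1}. \<Sum>r\<in>exps (length xs) (s - j). sigma_pow j x \<circ> op_prod (map2 sigma_pow r xs))"
    unfolding ladder_on_def list.size sum_exps_Suc[of _ "_ + 0"] add_Suc_right add_0_right sum_exps_Suc
    by (simp add: op_prod_def)
  also have "\<dots> = (\<Sum>j\<in>{-1, 0, 1}. sigma_pow j x \<circ> ladder_on xs (s - j))"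
    by (intro sum.cong refl ext) (simp add: ladder_on_def sum_fun_apply sigma_pow_sum)
  finally show ?thesis .
qed

section \<open>Agreement with the residue formula\<close>

lemma laurent_mult_ladder_factor:
  assumes "e = 1 \<or> e = -1"
  shows "laurent_mult (ladder_factor e i) g k = (\<Sum>j\<in>{-1, 0, 1}. sigma_pow j i \<circ> g (k + e * j))"
proof -
  have "laurent_mult (ladder_factor e i) g k =
      (\<Sum>j\<in>{-1, 0, 1}. ladder_factor e i j \<circ> g (k - j))"
    \<comment> \<open>The support may be enlarged to all three exponents, since the zero operator
      composed with anything is zero.\<close>
    unfolding laurent_mult_def
    by (rule sum.mono_neutral_left) (auto simp: ladder_factor_def fun_eq_iff split: if_splits)
  \<comment> \<open>The coefficient at degree \<open>m\<close> is
    \<open>sigma_pow (- e * m) i\<close>; as \<open>e * e = 1\<close>, substituting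
    \<open>m = - e * j\<close> sums over the exponent of sigma instead.\<close>
  also have "\<dots> = (\<Sum>j\<in>{-1, 0, 1}. sigma_pow j i \<circ> g (k + e * j))"
    using assms by (auto simp: ladder_factor_def sigma_pow_def ac_simps)
  finally show ?thesis .
qed

text \<open>An exponent \<open>j\<close> of sigma carries degree \<open>- e * j\<close>, so the
  degree of a product fixes its total exponent. The residue is the case \<open>k = -1\<close>, with
  total exponent \<open>e\<close>.\<close>

lemma laurent_prod_ladder_factor:
  assumes "e = 1 \<or> e = -1"
  shows "laurent_prod (map (ladder_factor e) xs) k = ladder_on xs (- e * k)"
proof (induction xs arbitrary: k)
  case Nil
  then show ?case
    using assms by (auto simp: laurent_prod_def laurent_one_def ladder_on_Nil fun_eq_iff)
next
  case (Cons x xs)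
  have "laurent_prod (map (ladder_factor e) (x # xs)) k =
      laurent_mult (ladder_factor e x) (laurent_prod (map (ladder_factor e) xs)) k"
    by (simp add: laurent_prod_def)
  also have "\<dots> = (\<Sum>j\<in>{-1, 0, 1}. sigma_pow j x \<circ> ladder_on xs (- e * (k + e * j)))"
    by (simp add: laurent_mult_ladder_factor[OF assms] Cons.IH)
  also have "\<dots> = ladder_on (x # xs) (- e * k)"
    unfolding ladder_on_Cons using assms by (intro sum.cong) (auto simp: algebra_simps)
  finally show ?case .
qed

section \<open>Matrix elements of the ladder operators\<close>

lemma sigma_pow_append:
  "sigma_pow j (length u) \<psi> (u @ c # v) =
     (if j = 1 then (if c = Up then \<psi> (u @ Down # v) else 0)
      else if j = -1 then (if c = Down then \<psi> (u @ Up # v) else 0)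
      else \<psi> (u @ c # v))"
  by (auto simp: sigma_pow_def site_op_def sigma_plus_def sigma_minus_def)

text \<open>Exactly one exponent list connects an output tail \<open>v\<close> with an input tail
  \<open>v'\<close>: at each site, half the difference of their steps. Its total is \<open>s\<close>
  iff \<open>mag v' = mag v - 2 * s\<close>. The prefix \<open>u\<close> keeps track of absolute
  site numbers in the induction.\<close>

lemma ladder_on_append:
  "ladder_on [length u..<length u + length v] s \<psi> (u @ v) =
     (\<Sum>v'\<in>sector (length v) (mag v - 2 * s). \<psi> (u @ v'))"
proof (induction v arbitrary: u s)
  case Nil
  have "sector 0 (- (2 * s)) = (if s = 0 then {[]} else {})"
    by (auto simp: sector_def mag_def)
  then show ?case
    by (simp add: ladder_on_Nil mag_def)
next
  case (Cons c v)
  let ?L = "\<lambda>s. ladder_on [Suc (length u)..<Suc (length u + length v)] s \<psi>"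
  \<comment> \<open>The operator at the first site may flip the letter there, hence an arbitrary
    \<open>d\<close>.\<close>
  have IH: "?L s' (u @ d # v) =
      (\<Sum>v'\<in>sector (length v) (mag v - 2 * s'). \<psi> (u @ d # v'))" for d s'
    using Cons.IH[of "u @ [d]" s'] by (simp del: upt_Suc)
  have "ladder_on [length u..<length u + length (c # v)] s \<psi> (u @ c # v) =
      (\<Sum>j\<in>{-1, 0, 1}. sigma_pow j (length u) (?L (s - j)) (u @ c # v))"
    by (subst upt_conv_Cons) (simp_all add: ladder_on_Cons sum_fun_apply del: upt_Suc)
  also have "\<dots> = (\<Sum>v'\<in>sector (length (c # v)) (mag (c # v) - 2 * s). \<psi> (u @ v'))"
  proof (cases c)
    \<comment> \<open>At an \<open>Up\<close> in the output only the exponents 0 and 1 survive; they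
      read the inputs beginning with \<open>Up\<close> and \<open>Down\<close>, the two halves of
      the sector.\<close>
    case Up
    have *: "mag (Up # v) - 2 * s - 1 = mag v - 2 * s" "mag (Up # v) - 2 * s + 1 = mag v - 2 * (s - 1)"
      by (simp_all add: mag_def step_def)
    then show ?thesis
      using Up by (simp add: sigma_pow_append IH sum_sector_Suc * del: upt_Suc)
  next
    case Down
    have *: "mag (Down # v) - 2 * s - 1 = mag v - 2 * (s - - 1)" "mag (Down # v) - 2 * s + 1 = mag v - 2 * s"
      by (simp_all add: mag_def step_def)
    then show ?thesis
      using Down by (simp add: sigma_pow_append IH sum_sector_Suc * del: upt_Suc)
  qed
  finally show ?case .
qed

lemma ladder_on_in_state_space: "\<psi> \<in> state_space N \<Longrightarrow> ladder_on xs s \<psi> \<in> state_space N"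
proof (induction xs arbitrary: s)
  case Nil
  then show ?case
    by (auto simp: ladder_on_Nil state_space_def)
next
  case (Cons x xs)
  have "sigma_pow j x (ladder_on xs s' \<psi>) \<in> state_space N" for j s'
    using Cons by (simp add: sigma_pow_def site_op_in_state_space)
  then show ?case
    by (auto simp: ladder_on_Cons state_space_def)
qed

text \<open>The case of an empty prefix. The value depends on \<open>w\<close> only through its
  length and magnetization, so every image is a combination of sector indicators.\<close>

lemma ladder_apply:
  assumes "\<psi> \<in> state_space N"
  shows "ladder N e \<psi> w = (if length w = N then \<Sum>w'\<in>sector N (mag w - 2 * e). \<psi> w' else 0)"
  using ladder_on_append[of "[]" w e \<psi>] ladder_on_in_state_space[OF assms, of "[0..<N]" e]
  by (auto simp: ladder_eq_ladder_on state_space_def)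


section \<open>The Hamiltonian\<close>

lemma site_op_n_up: "site_op n_up i \<psi> w = (if w ! i = Up then \<psi> w else 0)"
proof (cases "w ! i")
  case Up
  then have "w[i := Up] = w" by (metis list_update_id)
  with Up show ?thesis by (simp add: site_op_def n_up_def mat2_id_def sigma_z_def)
qed (simp add: site_op_def n_up_def mat2_id_def sigma_z_def)

lemma site_op_n_down: "site_op n_down i \<psi> w = (if w ! i = Down then \<psi> w else 0)"
proof (cases "w ! i")
  case Down
  then have "w[i := Down] = w" by (metis list_update_id)
  with Down show ?thesis by (simp add: site_op_def n_down_def mat2_id_def sigma_z_def)
qed (simp add: site_op_def n_down_def mat2_id_def sigma_z_def)

text \<open>Exchanging sites \<open>i\<close> and \<open>j\<close> leaves the letter at
  \<open>k\<close> alone, so the projector onto \<open>Down\<close> can be pulled out of the second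
  term.\<close>

lemma fredkin_density_eq:
  assumes "i \<noteq> k" "j \<noteq> k"
  shows "fredkin_density i j k \<psi> w =
    (if w ! i = Up then (\<psi> w - \<psi> (w[j := w ! k, k := w ! j])) / 2 else 0) +
    (if w ! k = Down then (\<psi> w - \<psi> (w[i := w ! j, j := w ! i])) / 2 else 0)"
  using assms
  by (simp add: fredkin_density_apply site_op_n_up site_op_n_down Pi_op_def scale_def exchange_def)

text \<open>The exchange is an involution of the sector that preserves the letter at
  \<open>i\<close>, so both parts of the difference have the same sum.\<close>

lemma sum_sector_swap:
  fixes \<psi> :: "spin list \<Rightarrow> 'a::ab_group_add"
  assumes "j < N" "k < N" "i \<noteq> j" "i \<noteq> k"
  shows "(\<Sum>w\<in>sector N M. if w ! i = c then \<psi> w - \<psi> (w[j := w ! k, k := w ! j]) else 0) = 0"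
proof -
  let ?s = "\<lambda>w. w[j := w ! k, k := w ! j]"
  have inv: "?s (?s w) = w" if "length w = N" for w :: "spin list"
    using that assms by (intro nth_equalityI) (auto simp: nth_list_update)
  have "(\<Sum>w\<in>sector N M. if w ! i = c then \<psi> (?s w) else 0) =
      (\<Sum>w\<in>sector N M. if w ! i = c then \<psi> w else 0)"
    by (rule sum.reindex_bij_witness[of _ ?s ?s])
      (use assms inv in \<open>auto simp: sector_def mag_swap\<close>)
  then have "(\<Sum>w\<in>sector N M. (if w ! i = c then \<psi> w else 0) - (if w ! i = c then \<psi> (?s w) else 0)) = 0"
    by (simp add: sum_subtractf)
  then show ?thesis
    by (rule trans[rotated]) (rule sum.cong, auto)
qed

text \<open>With only two sites, \<open>j + 2\<close> would wrap around to \<open>j\<close>.\<close>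

lemma next_sites_distinct:
  fixes N j :: nat
  assumes "N \<ge> 3" "j < N"
  shows "j \<noteq> (j + 1) mod N" "j \<noteq> (j + 2) mod N" "(j + 1) mod N \<noteq> (j + 2) mod N"
  using assms by (auto simp: mod_if)

text \<open>The Hamiltonian is annihilated from the left by every sector indicator.\<close>

lemma sum_sector_fredkin_H:
  assumes "N \<ge> 3"
  shows "(\<Sum>w\<in>sector N M. fredkin_H N \<psi> w) = 0"
proof -
  have "(\<Sum>w\<in>sector N M. fredkin_density j ((j + 1) mod N) ((j + 2) mod N) \<psi> w) = 0"
    if "j < N" for j
  proof -
    define k l where "k = (j + 1) mod N" and "l = (j + 2) mod N"
    have d: "j \<noteq> k" "j \<noteq> l" "k \<noteq> l" "k < N" "l < N"
      using next_sites_distinct[OF assms that] assms by (auto simp: k_def l_def)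
    have "(\<Sum>w\<in>sector N M. fredkin_density j k l \<psi> w) =
        (\<Sum>w\<in>sector N M. if w ! j = Up then \<psi> w - \<psi> (w[k := w ! l, l := w ! k]) else 0) / 2 +
        (\<Sum>w\<in>sector N M. if w ! l = Down then \<psi> w - \<psi> (w[j := w ! k, k := w ! j]) else 0) / 2"
      using d by (auto simp: fredkin_density_eq sum_divide_distrib simp flip: sum.distrib
          intro!: sum.cong)
    also have "\<dots> = 0"
      using d that by (subst (1 2) sum_sector_swap) auto
    finally show ?thesis
      by (simp only: k_def l_def)
  qed
  then have "(\<Sum>j<N. \<Sum>w\<in>sector N M. fredkin_density j ((j + 1) mod N) ((j + 2) mod N) \<psi> w) = 0"
    by simp
  then show ?thesis
    unfolding fredkin_H_def sum_fun_apply by (subst sum.swap)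
qed

text \<open>Exchanging sites preserves magnetization, so each factor \<open>1 - P\<close> kills such
  a state. Arbitrary \<open>g\<close> covers all images of the ladder operators.\<close>

lemma fredkin_H_function_of_mag:
  assumes "N \<ge> 3"
  shows "fredkin_H N (\<lambda>w. if length w = N then g (mag w) else 0) = 0"
proof -
  let ?\<phi> = "\<lambda>w. if length w = N then g (mag w) else 0"
  have swap: "?\<phi> (w[i := w ! j, j := w ! i]) = ?\<phi> w" if "i < N" "j < N" for i j w
    using that by (simp add: mag_swap)
  have "fredkin_density i j k ?\<phi> w = 0" if "i \<noteq> k" "j \<noteq> k" "i < N" "j < N" "k < N" for i j k w
    unfolding fredkin_density_eq[OF that(1,2)] swap[OF that(4,5)] swap[OF that(3,4)] by simp
  then have "fredkin_density j ((j + 1) mod N) ((j + 2) mod N) ?\<phi> w = 0" if "j < N" for j w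
    using next_sites_distinct[OF assms that] that assms by (auto simp del: One_nat_def)
  then show ?thesis
    by (simp add: fredkin_H_def fun_eq_iff sum_fun_apply)
qed

lemma fredkin_H_in_state_space:
  assumes "\<psi> \<in> state_space N"
  shows "fredkin_H N \<psi> \<in> state_space N"
proof -
  have "fredkin_density i j k \<psi> w = 0" if "length w \<noteq> N" for i j k w
    using assms that
    by (simp add: fredkin_density_apply site_op_n_up site_op_n_down Pi_op_def scale_def
        exchange_def state_space_def)
  then show ?thesis
    by (simp add: fredkin_H_def state_space_def sum_fun_apply)
qed

section \<open>Commutation and action on the ground states\<close>

lemma ladder_fredkin_H_commute:
  assumes "N \<ge> 3" "\<psi> \<in> state_space N"
  shows "ladder N e (fredkin_H N \<psi>) = fredkin_H N (ladder N e \<psi>)"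
proof -
  \<comment> \<open>Both products vanish separately. Here the ladder operator sums the image of the
    Hamiltonian over whole sectors.\<close>
  have "ladder N e (fredkin_H N \<psi>) = 0"
    using sum_sector_fredkin_H[OF assms(1)]
    by (simp add: fun_eq_iff ladder_apply[OF fredkin_H_in_state_space[OF assms(2)]])
  moreover have "fredkin_H N (ladder N e \<psi>) = 0"
    unfolding ext[OF ladder_apply[OF assms(2)]] by (rule fredkin_H_function_of_mag[OF assms(1)])
  ultimately show ?thesis
    by simp
qed

text \<open>Each word of the target sector collects one unit from every word of the source sector,
  so the constant is the size of the latter.\<close>

lemma ladder_ground_state:
  assumes "real_of_int M = 2 * S"
  shows "ladder N e (ground_state N S) =
    scale (of_nat (card (sector N M))) (ground_state N (S + real_of_int e))"
proof
  fix w
  have "ground_state N S \<in> state_space N"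
    by (simp add: state_space_def ground_state_apply)
  moreover have "(\<Sum>w'\<in>sector N (mag w - 2 * e). ground_state N S w') =
      (if mag w - 2 * e = M then of_nat (card (sector N M)) else 0)"
  proof -
    have "ground_state N S w' = (if mag w - 2 * e = M then 1 else 0)"
      if "w' \<in> sector N (mag w - 2 * e)" for w'
      using that by (auto simp: ground_state_apply sector_def simp flip: assms)
    then show ?thesis by simp
  qed
  moreover have "mag w - 2 * e = M \<longleftrightarrow> real_of_int (mag w) = 2 * (S + real_of_int e)"
  proof -
    have "2 * (S + real_of_int e) = real_of_int (M + 2 * e)"
      using assms by simp
    then show ?thesis
      by (simp only: of_int_eq_iff) linarith
  qed
  ultimately show "ladder N e (ground_state N S) w =
      scale (of_nat (card (sector N M))) (ground_state N (S + real_of_int e)) w"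
    by (simp add: ladder_apply scale_def ground_state_apply)
qed

theorem theorem2:
  fixes N :: nat and e :: int
  assumes "N \<ge> 3" and "e = 1 \<or> e = -1"
  shows "(\<forall>\<psi>\<in>state_space N.
            ladder N e \<psi> = laurent_res (laurent_prod (map (ladder_factor e) [0..<N])) \<psi>)
       \<and> (\<exists>c :: real \<Rightarrow> complex. \<forall>S\<in>spin_values N.
            c S \<noteq> 0 \<and>
            ladder N e (ground_state N S) =
              (if S \<noteq> real_of_int e * (real N / 2)
               then scale (c S) (ground_state N (S + real_of_int e))
               else 0))
       \<and> (\<forall>\<psi>\<in>state_space N. ladder N e (fredkin_H N \<psi>) = fredkin_H N (ladder N e \<psi>))"
\<comment> \<open>The constant counts the words of spin \<open>S\<close>. For admissible spins
  \<open>2 * S\<close> is an integer; the floor only changes its type.\<close>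
proof (intro conjI ballI exI[of _ "\<lambda>S. of_nat (card (sector N \<lfloor>2 * S\<rfloor>))"])
  fix \<psi>
  show "ladder N e \<psi> = laurent_res (laurent_prod (map (ladder_factor e) [0..<N])) \<psi>"
    by (simp add: laurent_res_def laurent_prod_ladder_factor[OF assms(2)] ladder_eq_ladder_on)
next
  fix S assume "S \<in> spin_values N"
  then obtain k where k: "k \<le> N" "S = - real N / 2 + real k"
    by (auto simp: spin_values_def)
  \<comment> \<open>Here \<open>k\<close> is the number of up spins; a word with \<open>k\<close>
    letters \<open>Up\<close> makes the constant nonzero.\<close>
  define M where "M = 2 * int k - int N"
  have M: "real_of_int M = 2 * S"
    using k by (simp add: M_def)
  then have floor: "\<lfloor>2 * S\<rfloor> = M"
    by (metis floor_of_int)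
  have "replicate k Up @ replicate (N - k) Down \<in> sector N M"
    using k(1) by (simp add: sector_def mag_def M_def sum_list_replicate step_def of_nat_diff)
  then show "of_nat (card (sector N \<lfloor>2 * S\<rfloor>)) \<noteq> (0 :: complex)"
    using finite_sector[of N M] by (auto simp: floor)
  show "ladder N e (ground_state N S) =
      (if S \<noteq> real_of_int e * (real N / 2)
       then scale (of_nat (card (sector N \<lfloor>2 * S\<rfloor>))) (ground_state N (S + real_of_int e)) else 0)"
  proof (cases "S = real_of_int e * (real N / 2)")
    case True
    \<comment> \<open>Beyond the extreme spin the magnetization would have absolute value
      \<open>N + 2\<close>, so the target state is zero.\<close>
    have "real_of_int (mag w) \<noteq> 2 * (S + real_of_int e)" if "length w = N" for w
    proof
      assume "real_of_int (mag w) = 2 * (S + real_of_int e)"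
      then have "real_of_int (mag w) = real_of_int (e * int N + 2 * e)"
        by (simp add: True)
      then have "mag w = e * int N + 2 * e"
        by linarith
      then show False
        using abs_mag_le[of w] that assms(2) by auto
    qed
    then have "ground_state N (S + real_of_int e) = 0"
      by (simp add: fun_eq_iff ground_state_apply)
    then have "ladder N e (ground_state N S) = 0"
      by (simp add: ladder_ground_state[OF M] fun_eq_iff scale_def)
    with True show ?thesis
      by simp
  next
    case False
    then show ?thesis
      by (simp add: ladder_ground_state[OF M] floor)
  qed
next
  fix \<psi> assume "\<psi> \<in> state_space N"
  then show "ladder N e (fredkin_H N \<psi>) = fredkin_H N (ladder N e \<psi>)"
    by (rule ladder_fredkin_H_commute[OF assms(1)])
qed

end
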